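(* Let $m\ge 2$. For $n\ge 0$ define $$Q^{(m)}_{n,123}(s,x_2,\ldots,x_m)=\sum_{\sigma\in\mathcal{S}_n(123)}s^{\mathrm{LRmin}(\sigma)}x_2^{\mathrm{occr}_{12}(\sigma)}x_3^{\mathrm{occr}_{132}(\sigma)}\cdots x_m^{\mathrm{occr}_{1m(m-1)\cdots 2}(\sigma)},$$ $$Q^{(m)}_{123}(t,s,x_2,\ldots,x_m)=\sum_{n\ge 0}t^nQ^{(m)}_{n,123}(s,x_2,\ldots,x_m).$$ Then for every $n\ge 1$, $$Q^{(m)}_{n,123}(s,x_2,\ldots,x_m)=s\,Q^{(m)}_{n-1,123}(s,x_2,\ldots,x_m)+\sum_{k=2}^{n}Q^{(m)}_{k-1,123}(sx_2,\,x_2x_3,\,x_3x_4,\ldots,x_{m-1}x_m,\,x_m)\,Q^{(m)}_{n-k,123}(s,x_2,\ldots,x_m),$$ and $$\begin{aligned}Q^{(m)}_{123}(t,s,x_2,\ldots,x_m)=1&+t(s-1)\,Q^{(m)}_{123}(t,s,x_2,\ldots,x_m)\\&+t\,Q^{(m)}_{123}(t,\,sx_2,\,x_2x_3,\,x_3x_4,\ldots,x_{m-1}x_m,\,x_m)\,Q^{(m)}_{123}(t,s,x_2,\ldots,x_m).\end{aligned}$$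
   Context: $\mathcal{S}_n$ is the set of permutations of $\{1,\ldots,n\}$ in one-line notation ($\mathcal{S}_0$ consists of the empty permutation, so the $n=0$ polynomial is $1$). For a sequence $w$ of distinct integers, $\mathrm{red}(w)$ is the permutation obtained by replacing the $i$-th smallest entry of $w$ by $i$. For $\tau\in\mathcal{S}_j$ and $\sigma=\sigma_1\cdots\sigma_n\in\mathcal{S}_n$, $\mathrm{occr}_\tau(\sigma)$ is the number of index sets $1\le i_1<\cdots<i_j\le n$ with $\mathrm{red}(\sigma_{i_1}\cdots\sigma_{i_j})=\tau$. $\mathcal{S}_n(123)$ is the set of $\sigma\in\mathcal{S}_n$ with $\mathrm{occr}_{123}(\sigma)=0$. The entry $\sigma_j$ is a left-to-right minimum of $\sigma$ if $\sigma_i>\sigma_j$ for all $i<j$; $\mathrm{LRmin}(\sigma)$ is the number of left-to-right minima. For $j\ge2$, $1j(j-1)\cdots2$ denotes the pattern in $\mathcal{S}_j$ with first entry $1$ followed by $j,j-1,\ldots,2$ (so $12$ for $j=2$, $132$ for $j=3$); the exponent of $x_j$ is the number of its occurrences. In the argument list $(sx_2,x_2x_3,\ldots,x_{m-1}x_m,x_m)$, $s$ is replaced by $sx_2$, $x_i$ by $x_ix_{i+1}$ for $2\le i\le m-1$, and $x_m$ is unchanged (for $m=2$ the list is $(sx_2,x_2)$). *)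

theory Defs
  imports
    "HOL-Combinatorics.Multiset_Permutations"
    "HOL-Computational_Algebra.Formal_Power_Series"
begin

definition red :: "nat list \<Rightarrow> nat list" where
  "red w = map (\<lambda>a. card {b \<in> set w. b \<le> a}) w"

text \<open>Positions are counted from 0, as usual for lists; this does not affect the number of
  index sets.\<close>

definition occr :: "nat list \<Rightarrow> nat list \<Rightarrow> nat" where
  "occr \<tau> \<sigma> =
     card {I. I \<subseteq> {..<length \<sigma>} \<and> card I = length \<tau> \<and> red (nths \<sigma> I) = \<tau>}"

text \<open>Permutations of \<open>{1..n}\<close> in one-line notation are the elements of
  \<open>permutations_of_set {1..n}\<close>.\<close>

definition avoiders :: "nat \<Rightarrow> nat list \<Rightarrow> nat list set" where
  "avoiders n \<tau> = {\<sigma> \<in> permutations_of_set {1..n}. occr \<tau> \<sigma> = 0}"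

definition LRmin :: "nat list \<Rightarrow> nat" where
  "LRmin \<sigma> = card {j. j < length \<sigma> \<and> (\<forall>i<j. \<sigma> ! i > \<sigma> ! j)}"

text \<open>The pattern \<open>1 j (j-1) \<dots> 2\<close>, for \<open>j \<ge> 2\<close>.\<close>

definition one_desc :: "nat \<Rightarrow> nat list" where
  "one_desc j = 1 # rev [2..<Suc j]"

text \<open>The polynomials are represented by their values at arbitrary elements of a commutative
  ring; the variables \<open>x\<^sub>2, \<dots>, x\<^sub>m\<close> are given by a function, of which only the values on
  \<open>{2..m}\<close> matter. As the ring is arbitrary, it may be taken to be the polynomial ring over the
  integers and \<open>s\<close>, \<open>x j\<close> its indeterminates.\<close>

definition Qpoly :: "nat \<Rightarrow> nat list \<Rightarrow> nat \<Rightarrow> 'a :: comm_ring_1 \<Rightarrow> (nat \<Rightarrow> 'a) \<Rightarrow> 'a" where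
  "Qpoly m \<tau> n s x =
     (\<Sum>\<sigma>\<in>avoiders n \<tau>. s ^ LRmin \<sigma> * (\<Prod>j=2..m. x j ^ occr (one_desc j) \<sigma>))"

text \<open>The variable \<open>t\<close> is the formal power series variable.\<close>

definition Qgf :: "nat \<Rightarrow> nat list \<Rightarrow> 'a :: comm_ring_1 \<Rightarrow> (nat \<Rightarrow> 'a) \<Rightarrow> 'a fps" where
  "Qgf m \<tau> s x = Abs_fps (\<lambda>n. Qpoly m \<tau> n s x)"

text \<open>The arguments \<open>x\<^sub>2x\<^sub>3, x\<^sub>3x\<^sub>4, \<dots>, x\<^sub>m\<^sub>-\<^sub>1x\<^sub>m, x\<^sub>m\<close>.\<close>

definition shift_vars :: "nat \<Rightarrow> (nat \<Rightarrow> 'a :: comm_ring_1) \<Rightarrow> nat \<Rightarrow> 'a" where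
  "shift_vars m x j = (if j < m then x j * x (Suc j) else x j)"

end

theory Submission
  imports Defs "HOL-Library.Sublist"
begin

text \<open>In a 123-avoider the entries larger than a given entry and to the right of it decrease, so an
  entry with \<open>d\<close> such larger entries starts \<open>d choose (j - 1)\<close> occurrences of \<open>1 j (j-1) \<dots> 2\<close>, and
  \<open>d = 0\<close> unless the entry is a left-to-right minimum. Hence the weight of a permutation is a product
  over its left-to-right minima of \<open>f d = s * (\<Prod>j=2..m. x j ^ (d choose (j - 1)))\<close>. Building the
  permutation from left to right turns it into a Dyck path whose peaks, of height \<open>d + 1\<close>,
  are the left-to-right minima. Decomposing the path at its first return to the axis gives the
  recurrence: the part inside the first arch is raised by one, which replaces \<open>f d\<close> by \<open>f (Suc d)\<close>,
  and by Pascal's rule this is the given substitution of variables.\<close>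

section \<open>Weighted Dyck paths and their first-return decomposition\<close>

text \<open>The weighted count of the ways to complete a Dyck path from height \<open>b\<close> with \<open>a\<close> up-steps left,
  immediately after a down-step or at the start. The next move is a down-step, or a run of
  \<open>a - a'\<close> up-steps and the down-step after it. In terms of permutations, \<open>a\<close> and \<open>b\<close> count the
  unused values below and above the current minimum.\<close>

function paths :: "(nat \<Rightarrow> 'a :: comm_ring_1) \<Rightarrow> nat \<Rightarrow> nat \<Rightarrow> 'a" where
  "paths f a b =
     (if a = 0 \<and> b = 0 then 1
      else (if b = 0 then 0 else paths f a (b - 1)) +
        (\<Sum>a'<a. f (a + b - Suc a') * paths f a' (a + b - Suc a')))"
  by auto
text \<open>Every move contains exactly one down-step, and \<open>a + b\<close> down-steps remain in
  total.\<close>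

termination by (relation "measure (\<lambda>(f, a, b). a + b)") auto

declare paths.simps [simp del]

lemma paths_0_0 [simp]: "paths f 0 0 = 1"
  by (simp add: paths.simps)

lemma paths_Suc_right:
  "paths f a (Suc b) = paths f a b + (\<Sum>a'<a. f (a + b - a') * paths f a' (a + b - a'))"
  by (subst paths.simps) simp

lemma paths_Suc_0: "paths f (Suc a) 0 = (\<Sum>a'\<le>a. f (a - a') * paths f a' (a - a'))"
  by (subst paths.simps) (simp add: lessThan_Suc_atMost)

text \<open>Meant for a path whose first run leaves \<open>a'\<close> up-steps, \<open>i\<close> of
  them before the first visit to the axis. The new outer index \<open>a + i - a'\<close> counts all
  up-steps before that visit, the first run included.\<close>

lemma sum_paths_triangle:
  fixes f :: "nat \<Rightarrow> 'a :: comm_ring_1"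
  shows "(\<Sum>a'<a. f (a + b - a') * (\<Sum>i\<le>a'. g i (a + b - Suc a') * h (a' - i))) =
    (\<Sum>i\<le>a. (\<Sum>i'<i. f (i + b - i') * g i' (i + b - Suc i')) * h (a - i))"
proof -
  have "(\<Sum>a'<a. f (a + b - a') * (\<Sum>i\<le>a'. g i (a + b - Suc a') * h (a' - i))) =
      (\<Sum>(a', i)\<in>(SIGMA a':{..<a}. {..a'}).
         f (a + b - a') * (g i (a + b - Suc a') * h (a' - i)))"
    by (simp add: sum.Sigma sum_distrib_left)
  also have "\<dots> = (\<Sum>(i, i')\<in>(SIGMA i:{..a}. {..<i}).
      f (i + b - i') * g i' (i + b - Suc i') * h (a - i))"
    by (rule sum.reindex_bij_witness[where
          i = "\<lambda>(i, i'). (a + i' - i, i')" and j = "\<lambda>(a', i). (a + i - a', i)"])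
       (auto simp: mult.assoc)
  also have "\<dots> = (\<Sum>i\<le>a. (\<Sum>i'<i. f (i + b - i') * g i' (i + b - Suc i')) * h (a - i))"
    by (simp add: sum.Sigma sum_distrib_right)
  finally show ?thesis .
qed

text \<open>Cut the path at its first visit to the axis. The part before the cut stays above the
  axis; lowering it by one turns \<open>f\<close> into \<open>\<lambda>d. f (Suc d)\<close>. The
  down-step at the cut follows another down-step, so it makes no peak. The induction splits off the
  first move.\<close>

lemma paths_first_passage:
  "paths f a (Suc b) = (\<Sum>i\<le>a. paths (\<lambda>d. f (Suc d)) i b * paths f (a - i) 0)"
proof (induction "a + b" arbitrary: a b rule: less_induct)
  case less
  define f' where "f' = (\<lambda>d. f (Suc d))"
  \<comment> \<open>\<open>D\<close> covers the case that the first move is a down-step. For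
    \<open>b = 0\<close> it already reaches the axis, so no up-step lies before the cut.\<close>
  define D where "D i = (if b = 0 then if i = 0 then 1 else 0 else paths f' i (b - 1))" for i
  have D: "paths f a b = (\<Sum>i\<le>a. D i * paths f (a - i) 0)"
  proof (cases b)
    case 0
    then have "(\<Sum>i\<le>a. D i * paths f (a - i) 0) = (\<Sum>i\<in>{0}. D i * paths f (a - i) 0)"
      by (intro sum.mono_neutral_right) (auto simp: D_def)
    then show ?thesis using 0 by (simp add: D_def)
  next
    case (Suc c)
    then show ?thesis using less[of a c] by (simp add: D_def f'_def)
  qed
  have f'_step: "paths f' i b = D i + (\<Sum>i'<i. f (i + b - i') * paths f' i' (i + b - Suc i'))" for i
    by (subst paths.simps) (auto simp: D_def f'_def Suc_diff_Suc intro!: sum.cong)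
  have "f (a + b - a') * paths f a' (a + b - a') =
      f (a + b - a') * (\<Sum>i\<le>a'. paths f' i (a + b - Suc a') * paths f (a' - i) 0)"
    if "a' < a" for a'
  proof -
    have "a + b - a' = Suc (a + b - Suc a')" using that by simp
    moreover have "a' + (a + b - Suc a') < a + b" using that by simp
    ultimately show ?thesis using less[of a' "a + b - Suc a'"] by (simp add: f'_def)
  qed
  then have "paths f a (Suc b) = paths f a b +
      (\<Sum>a'<a. f (a + b - a') * (\<Sum>i\<le>a'. paths f' i (a + b - Suc a') * paths f (a' - i) 0))"
    by (simp add: paths_Suc_right)
  also have "\<dots> = (\<Sum>i\<le>a. paths f' i b * paths f (a - i) 0)"
    by (subst sum_paths_triangle)
       (simp add: D f'_step distrib_right sum.distrib)
  finally show ?case by (simp add: f'_def)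
qed

text \<open>\<open>k\<close> counts the up-steps strictly inside the first arch. An empty arch is
  itself a peak, of weight \<open>f 0\<close>, which the raised count at \<open>k = 0\<close> would
  miss; hence the separate term.\<close>

lemma paths_recurrence:
  "paths f (Suc n) 0 = f 0 * paths f n 0 +
     (\<Sum>k=1..n. paths (\<lambda>d. f (Suc d)) k 0 * paths f (n - k) 0)"
proof -
  define f' where "f' = (\<lambda>d. f (Suc d))"
  have "paths f (Suc n) 0 = (\<Sum>a'\<le>n. f (n - a') * paths f a' (n - a'))"
    by (rule paths_Suc_0)
  also have "\<dots> = f 0 * paths f n 0 + (\<Sum>a'<n. f (n - a') * paths f a' (n - a'))"
    by (simp flip: lessThan_Suc_atMost)
  \<comment> \<open>A first run of at least two up-steps leads to a positive height after its
    down-step, so the first-passage cut applies. The \<open>+ 0\<close> matches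
    \<open>sum_paths_triangle\<close> at \<open>b = 0\<close>.\<close>
  also have "(\<Sum>a'<n. f (n - a') * paths f a' (n - a')) =
      (\<Sum>a'<n. f (n + 0 - a') * (\<Sum>i\<le>a'. paths f' i (n + 0 - Suc a') * paths f (a' - i) 0))"
  proof (rule sum.cong)
    fix a' assume "a' \<in> {..<n}"
    then have "n - a' = Suc (n - Suc a')" by simp
    then show "f (n - a') * paths f a' (n - a') =
        f (n + 0 - a') * (\<Sum>i\<le>a'. paths f' i (n + 0 - Suc a') * paths f (a' - i) 0)"
      using paths_first_passage[of f a' "n - Suc a'"] by (simp add: f'_def)
  qed simp
  also have "\<dots> = (\<Sum>i\<le>n. (\<Sum>i'<i. f (i + 0 - i') * paths f' i' (i + 0 - Suc i')) * paths f (n - i) 0)"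
    by (rule sum_paths_triangle)
  also have "\<dots> = (\<Sum>i=1..n. (\<Sum>i'<i. f (i + 0 - i') * paths f' i' (i + 0 - Suc i')) * paths f (n - i) 0)"
    by (rule sum.mono_neutral_right) (auto simp: Suc_le_eq)
  \<comment> \<open>For \<open>k \<ge> 1\<close> the inner sum is the expansion of
    \<open>paths f' k 0\<close> by its first run.\<close>
  also have "\<dots> = (\<Sum>k=1..n. paths f' k 0 * paths f (n - k) 0)"
  proof (rule sum.cong)
    fix k assume "k \<in> {1..n}"
    then obtain j where "k = Suc j" by (cases k) auto
    then show "(\<Sum>i'<k. f (k + 0 - i') * paths f' i' (k + 0 - Suc i')) * paths f (n - k) 0 =
        paths f' k 0 * paths f (n - k) 0"
      by (auto simp: paths_Suc_0 lessThan_Suc_atMost f'_def Suc_diff_le intro!: sum.cong)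
  qed simp
  finally show ?thesis by (simp add: f'_def)
qed

section \<open>Continuations of 123-avoiding prefixes, counted by paths\<close>

text \<open>Avoidance of 123, in a form that can be checked entry by entry.\<close>

primrec avoids :: "nat list \<Rightarrow> bool" where
  "avoids [] \<longleftrightarrow> True"
| "avoids (y # ys) \<longleftrightarrow> sorted_wrt (\<ge>) (filter (\<lambda>z. y < z) ys) \<and> avoids ys"

text \<open>\<open>v\<close> stands for the minimum of the entries already placed, so
  \<open>y < v\<close> detects a new left-to-right minimum.\<close>

primrec weight :: "(nat \<Rightarrow> 'a :: comm_ring_1) \<Rightarrow> nat \<Rightarrow> nat list \<Rightarrow> 'a" where
  "weight f v [] = 1"
| "weight f v (y # ys) =
     (if y < v then f (length (filter (\<lambda>z. y < z) ys)) * weight f y ys else weight f v ys)"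

text \<open>The possible continuations of a 123-avoiding prefix with minimum \<open>v\<close> by the unused values \<open>R\<close>.\<close>

definition fillings :: "nat \<Rightarrow> nat set \<Rightarrow> nat list set" where
  "fillings v R =
     {w \<in> permutations_of_set R. sorted_wrt (\<ge>) (filter (\<lambda>z. v < z) w) \<and> avoids w}"

lemma sum_rank_less:
  fixes A :: "nat set"
  assumes "finite A"
  shows "(\<Sum>y\<in>A. g (card {r \<in> A. r < y})) = (\<Sum>i<card A. g i)"
  using assms
proof (induction A rule: finite_linorder_max_induct)
  case (insert b A)
  have "{r \<in> insert b A. r < y} = {r \<in> A. r < y}" if "y \<in> A" for y
    using insert(2) that by auto
  moreover have "{r \<in> insert b A. r < b} = A" using insert(2) by auto
  moreover have "b \<notin> A" using insert(2) by auto
  ultimately show ?case using insert by (simp add: add.commute)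
qed simp

lemma Cons_in_fillings_less:
  assumes "y < v" "y \<in> R"
  shows "y # w \<in> fillings v R \<longleftrightarrow> w \<in> fillings y (R - {y})"
proof -
  have "filter (\<lambda>z. v < z) w = filter (\<lambda>z. v < z) (filter (\<lambda>z. y < z) w)"
    using assms by (auto intro!: filter_cong)
  then have "sorted_wrt (\<ge>) (filter (\<lambda>z. v < z) w)" if "sorted_wrt (\<ge>) (filter (\<lambda>z. y < z) w)"
    using that by (metis sorted_wrt_filter)
  then show ?thesis
    using assms by (auto simp: fillings_def permutations_of_set_def)
qed

text \<open>A larger value placed after \<open>y\<close> would complete a 123 with \<open>v\<close>
  and \<open>y\<close>. So an entry above the current minimum is forced, like a down-step.\<close>

lemma Cons_in_fillings_greater:
  assumes "y > v" "y \<in> R"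
  shows "y # w \<in> fillings v R \<longleftrightarrow> (\<forall>r\<in>R. r \<le> y) \<and> w \<in> fillings v (R - {y})"
proof
  assume *: "y # w \<in> fillings v R"
  have "r \<le> y" if "r \<in> R" for r
    using * that assms by (cases "v < r") (auto simp: fillings_def permutations_of_set_def)
  with * show "(\<forall>r\<in>R. r \<le> y) \<and> w \<in> fillings v (R - {y})"
    using assms by (auto simp: fillings_def permutations_of_set_def)
next
  assume *: "(\<forall>r\<in>R. r \<le> y) \<and> w \<in> fillings v (R - {y})"
  then have "filter (\<lambda>z. y < z) w = []"
    by (auto simp: fillings_def permutations_of_set_def filter_empty_conv)
  with * show "y # w \<in> fillings v R"
    using assms by (auto simp: fillings_def permutations_of_set_def)
qed

lemma finite_fillings [simp]: "finite (fillings v R)"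
  by (simp add: fillings_def)

lemma sum_weight_fillings:
  assumes "finite R" "v \<notin> R"
  shows "(\<Sum>w\<in>fillings v R. weight f v w) = paths f (card {r \<in> R. r < v}) (card {r \<in> R. v < r})"
  using assms
proof (induction "card R" arbitrary: R v)
  case 0
  then have "fillings v R = {[]}" by (auto simp: fillings_def)
  with 0 show ?case by simp
next
  case (Suc k)
  define A where "A = {r \<in> R. r < v}"
  define B where "B = {r \<in> R. v < r}"
  have fin: "finite A" "finite B" using Suc.prems by (auto simp: A_def B_def)
  have R: "R = A \<union> B" "A \<inter> B = {}"
    using Suc.prems by (auto simp: A_def B_def) (metis linorder_neqE_nat)
  have cardR: "card R = card A + card B" using R fin by (simp add: card_Un_disjoint)
  have step: "(\<Sum>w\<in>{w. y # w \<in> fillings v R}. weight f v (y # w)) =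
      f (card A + card B - Suc (card {r \<in> A. r < y})) *
      paths f (card {r \<in> A. r < y}) (card A + card B - Suc (card {r \<in> A. r < y}))"
    if y: "y \<in> A" for y
  proof -
    have yv: "y < v" "y \<in> R" using y by (auto simp: A_def)
    define b where "b = card {r \<in> R - {y}. y < r}"
    have less_y: "{r \<in> R - {y}. r < y} = {r \<in> A. r < y}" using yv by (auto simp: A_def)
    have "card (R - {y}) = card ({r \<in> R - {y}. r < y} \<union> {r \<in> R - {y}. y < r})"
      by (rule arg_cong[where f = card]) auto
    also have "\<dots> = card {r \<in> R - {y}. r < y} + b"
      using Suc.prems(1) unfolding b_def by (intro card_Un_disjoint) auto
    finally have b: "card A + card B - Suc (card {r \<in> A. r < y}) = b"
      using yv Suc.prems(1) cardR less_y by simp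
    have len: "length (filter (\<lambda>z. y < z) w) = b" if "w \<in> fillings y (R - {y})" for w
    proof -
      from that have "distinct w" "set w = R - {y}"
        by (auto simp: fillings_def permutations_of_set_def)
      then show ?thesis
        by (metis b_def distinct_card distinct_filter set_filter)
    qed
    have "(\<Sum>w\<in>{w. y # w \<in> fillings v R}. weight f v (y # w)) =
        (\<Sum>w\<in>fillings y (R - {y}). f b * weight f y w)"
      using yv by (intro sum.cong) (auto simp: Cons_in_fillings_less len)
    also have "\<dots> = f b * paths f (card {r \<in> R - {y}. r < y}) b"
      using Suc.hyps(1)[of "R - {y}" y] Suc.hyps(2) Suc.prems yv
      by (simp add: b_def flip: sum_distrib_left)
    finally show ?thesis unfolding b less_y .
  qed
  \<comment> \<open>Only the largest element of \<open>B\<close> can come first.\<close>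
  have stepB: "(\<Sum>y\<in>B. \<Sum>w\<in>{w. y # w \<in> fillings v R}. weight f v (y # w)) =
      (if card B = 0 then 0 else paths f (card A) (card B - 1))"
  proof (cases "B = {}")
    case False
    define y where "y = Max B"
    have y: "y \<in> B" "\<And>r. r \<in> B \<Longrightarrow> r \<le> y"
      using False fin by (auto simp: y_def)
    have yv: "v < y" "y \<in> R" using y(1) by (auto simp: B_def)
    have y_max: "r \<le> y" if "r \<in> R" for r
      using that y(2)[of r] yv by (cases "v < r") (auto simp: B_def)
    have "{w. z # w \<in> fillings v R} = {}" if "z \<in> B - {y}" for z
    proof -
      have "v < z" "z \<in> R" "z < y"
        using that y(2)[of z] by (auto simp: B_def)
      then show ?thesis
        using Cons_in_fillings_greater[of v z R] yv(2) linorder_not_less by blast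
    qed
    then have "(\<Sum>y\<in>B. \<Sum>w\<in>{w. y # w \<in> fillings v R}. weight f v (y # w)) =
        (\<Sum>y\<in>{y}. \<Sum>w\<in>{w. y # w \<in> fillings v R}. weight f v (y # w))"
      using y fin by (intro sum.mono_neutral_right) auto
    also have "\<dots> = (\<Sum>w\<in>fillings v (R - {y}). weight f v w)"
      using yv y_max by (auto simp: Cons_in_fillings_greater intro!: sum.cong)
    also have "\<dots> = paths f (card {r \<in> R - {y}. r < v}) (card {r \<in> R - {y}. v < r})"
      using Suc.hyps Suc.prems yv by simp
    also have "{r \<in> R - {y}. r < v} = A" using yv by (auto simp: A_def)
    also have "{r \<in> R - {y}. v < r} = B - {y}" by (auto simp: B_def)
    also have "card (B - {y}) = card B - 1" using y by simp
    finally show ?thesis using False fin by simp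
  qed simp
  have "fillings v R = (\<lambda>(y, w). y # w) ` (SIGMA y:R. {w. y # w \<in> fillings v R})"
  proof (intro equalityI subsetI)
    fix u assume u: "u \<in> fillings v R"
    then have "set u = R" by (simp add: fillings_def permutations_of_set_def)
    moreover from this have "u \<noteq> []" using Suc.hyps(2) by auto
    ultimately show "u \<in> (\<lambda>(y, w). y # w) ` (SIGMA y:R. {w. y # w \<in> fillings v R})"
      using u by (cases u) force+
  qed auto
  moreover have "inj_on (\<lambda>(y, w). y # w) (SIGMA y:R. {w. y # w \<in> fillings v R})"
    by (auto intro: inj_onI)
  ultimately have "(\<Sum>w\<in>fillings v R. weight f v w) =
      (\<Sum>(y, w)\<in>(SIGMA y:R. {w. y # w \<in> fillings v R}). weight f v (y # w))"
    by (intro sum.reindex_cong[where l = "\<lambda>(y, w). y # w"]) (simp_all only: case_prod_unfold)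
  also have "\<dots> = (\<Sum>y\<in>R. \<Sum>w\<in>{w. y # w \<in> fillings v R}. weight f v (y # w))"
    using Suc.prems(1) finite_vimageI[OF finite_fillings[of v R], of "Cons y" for y]
    by (subst sum.Sigma) (auto simp: vimage_def simp del: weight.simps)
  also have "\<dots> = (\<Sum>y\<in>B. \<Sum>w\<in>{w. y # w \<in> fillings v R}. weight f v (y # w)) +
      (\<Sum>y\<in>A. \<Sum>w\<in>{w. y # w \<in> fillings v R}. weight f v (y # w))"
    unfolding R(1) using R(2) fin by (subst sum.union_disjoint) (auto simp: add.commute)
  also have "(\<Sum>y\<in>A. \<Sum>w\<in>{w. y # w \<in> fillings v R}. weight f v (y # w)) =
      (\<Sum>a'<card A. f (card A + card B - Suc a') * paths f a' (card A + card B - Suc a'))"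
    by (simp only: step sum_rank_less[OF fin(1), symmetric] cong: sum.cong)
  also have "(\<Sum>y\<in>B. \<Sum>w\<in>{w. y # w \<in> fillings v R}. weight f v (y # w)) + \<dots> =
      paths f (card A) (card B)"
    using Suc.hyps(2) cardR
    by (subst paths.simps[of f "card A" "card B"]) (auto simp: stepB simp del: weight.simps)
  finally show ?case by (simp add: A_def B_def)
qed

section \<open>Reduction and occurrences of 123\<close>

lemma length_red [simp]: "length (red w) = length w"
  by (simp add: red_def)

lemma nth_red: "i < length w \<Longrightarrow> red w ! i = card {b \<in> set w. b \<le> w ! i}"
  by (simp add: red_def)

lemma red_less_iff:
  assumes "i < length w" "j < length w"
  shows "red w ! i < red w ! j \<longleftrightarrow> w ! i < w ! j"
proof -
  have mono: "card {b \<in> set w. b \<le> u} \<le> card {b \<in> set w. b \<le> v}" if "u \<le> v" for u v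
    using that by (intro card_mono) auto
  have "card {b \<in> set w. b \<le> u} < card {b \<in> set w. b \<le> v}" if "u < v" "v \<in> set w" for u v
    using that by (intro psubset_card_mono) (auto simp: psubset_eq set_eq_iff intro!: exI[of _ v])
  with mono show ?thesis
    using assms by (metis linorder_not_less nth_mem nth_red)
qed

lemma red_eq_123_iff: "red w = [1, 2, 3] \<longleftrightarrow> (\<exists>p q r. w = [p, q, r] \<and> p < q \<and> q < r)"
proof
  assume *: "red w = [1, 2, 3]"
  then have len: "length w = 3" using length_red[of w] by simp
  then obtain p q r where w: "w = [p, q, r]"
    by (auto simp: numeral_3_eq_3 length_Suc_conv)
  have "p < q" "q < r"
    using red_less_iff[of 0 w 1] red_less_iff[of 1 w 2] * w by auto
  with w show "\<exists>p q r. w = [p, q, r] \<and> p < q \<and> q < r" by blast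
next
  assume "\<exists>p q r. w = [p, q, r] \<and> p < q \<and> q < r"
  then obtain p q r where w: "w = [p, q, r]" and less: "p < q" "q < r" by blast
  have "{b \<in> set w. b \<le> p} = {p}" "{b \<in> set w. b \<le> q} = {p, q}"
    "{b \<in> set w. b \<le> r} = {p, q, r}"
    using w less by auto
  then show "red w = [1, 2, 3]" using w less by (simp add: red_def)
qed

text \<open>Subsequences mediate between the index sets of \<open>occr\<close> and the recursion of
  \<open>avoids\<close>; this is the case split on whether the head is used.\<close>

lemma subseq_Cons_Cons_iff:
  "subseq (x # xs) (y # ys) \<longleftrightarrow> x = y \<and> subseq xs ys \<or> subseq (x # xs) ys"
  by (auto dest: subseq_Cons')

lemma sorted_wrt_iff_subseq: "sorted_wrt P ys \<longleftrightarrow> (\<forall>q r. subseq [q, r] ys \<longrightarrow> P q r)"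
  by (induction ys) (auto simp: subseq_Cons_Cons_iff subseq_singleton_left simp del: subseq_Cons2_iff)

lemma subseq_filter_iff: "subseq zs (filter P ys) \<longleftrightarrow> subseq zs ys \<and> (\<forall>z\<in>set zs. P z)"
proof
  assume *: "subseq zs (filter P ys)"
  then obtain N where zs: "zs = nths (filter P ys) N" by (auto simp: subseq_conv_nths)
  have "set zs \<subseteq> set (filter P ys)" unfolding zs by (rule set_nths_subset)
  then show "subseq zs ys \<and> (\<forall>z\<in>set zs. P z)"
    using * subseq_order.trans[OF * subseq_filter_left] by auto
next
  assume "subseq zs ys \<and> (\<forall>z\<in>set zs. P z)"
  then show "subseq zs (filter P ys)"
    by (metis filter_True subseq_filter)
qed

lemma avoids_iff_subseq:
  "avoids w \<longleftrightarrow> (\<forall>p q r. p < q \<longrightarrow> q < r \<longrightarrow> \<not> subseq [p, q, r] w)"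
proof (induction w)
  case (Cons y ys)
  have "(\<forall>q r. subseq [q, r] ys \<and> y < q \<and> y < r \<longrightarrow> q \<ge> r) \<longleftrightarrow>
      (\<forall>q r. y < q \<longrightarrow> q < r \<longrightarrow> \<not> subseq [q, r] ys)"
    by (meson linorder_not_less order_less_trans)
  then show ?case
    unfolding avoids.simps Cons.IH sorted_wrt_iff_subseq subseq_filter_iff subseq_Cons_Cons_iff
    by auto
qed simp

lemma finite_occr: "finite {I. I \<subseteq> {..<length \<sigma>} \<and> P I}"
  by (rule finite_subset[of _ "Pow {..<length \<sigma>}"]) auto

lemma occr_123_eq_0_iff: "occr [1, 2, 3] w = 0 \<longleftrightarrow> avoids w"
proof -
  have "occr [1, 2, 3] w = 0 \<longleftrightarrow>
      (\<forall>I\<subseteq>{..<length w}. card I = 3 \<longrightarrow> red (nths w I) \<noteq> [1, 2, 3])"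
    unfolding occr_def by (subst card_0_eq[OF finite_occr]) auto
  also have "\<dots> \<longleftrightarrow> (\<forall>u. subseq u w \<longrightarrow> red u \<noteq> [1, 2, 3])"
  proof (intro iffI allI impI notI)
    fix u assume *: "\<forall>I\<subseteq>{..<length w}. card I = 3 \<longrightarrow> red (nths w I) \<noteq> [1, 2, 3]"
      and "subseq u w" and red: "red u = [1, 2, 3]"
    then obtain N where "u = nths w N" by (auto simp: subseq_conv_nths)
    \<comment> \<open>\<open>nths\<close> ignores positions beyond the end, but the cardinality does
      not; so they are removed.\<close>
    define I where "I = {i. i < length w \<and> i \<in> N}"
    have u: "u = nths w I"
      unfolding \<open>u = nths w N\<close> I_def nths_def
      by (intro arg_cong[where f = "map fst"] filter_cong) (auto simp: set_zip)
    then have "length u = card I"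
      by (auto simp: length_nths I_def intro!: arg_cong[where f = card])
    moreover have "length u = 3" using length_red[of u] red by simp
    moreover have "I \<subseteq> {..<length w}" by (auto simp: I_def)
    ultimately show False using * u red by auto
  qed (auto simp: subseq_conv_nths)
  also have "\<dots> \<longleftrightarrow> avoids w"
    unfolding red_eq_123_iff avoids_iff_subseq by blast
  finally show ?thesis .
qed

section \<open>Occurrences of the patterns \<open>one_desc j\<close>\<close>

lemma length_one_desc [simp]: "j \<ge> 1 \<Longrightarrow> length (one_desc j) = j"
  by (simp add: one_desc_def del: upt_Suc)

text \<open>The head is the largest entry: its rank is the length, and it does not affect the ranks
  in the tail.\<close>

lemma map_rank_decreasing:
  fixes w :: "nat list"
  shows "sorted_wrt (>) w \<Longrightarrow> map (\<lambda>a. card {b \<in> set w. b \<le> a}) w = rev [1..<Suc (length w)]"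
proof (induction w)
  case (Cons y ys)
  have "{b \<in> set (y # ys). b \<le> y} = set (y # ys)" using Cons.prems by auto
  moreover have "card (set (y # ys)) = Suc (length ys)"
    using Cons.prems by (metis distinct_card length_Cons sorted_wrt_rev strict_sorted_iff
      distinct_rev rev_rev_ident)
  moreover have "{b \<in> set (y # ys). b \<le> a} = {b \<in> set ys. b \<le> a}" if "a \<in> set ys" for a
    using Cons.prems that by auto
  then have "map (\<lambda>a. card {b \<in> set (y # ys). b \<le> a}) ys =
      map (\<lambda>a. card {b \<in> set ys. b \<le> a}) ys"
    by (intro map_cong) (simp_all only:)
  then have "map (\<lambda>a. card {b \<in> set (y # ys). b \<le> a}) ys = rev [1..<Suc (length ys)]"
    using Cons by (simp only: sorted_wrt.simps)
  ultimately show ?case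
    by (simp add: upt_Suc_append del: upt_Suc)
qed simp

lemma red_Cons_eq_one_desc_iff:
  "red (x # w) = one_desc (Suc (length w)) \<longleftrightarrow> (\<forall>y\<in>set w. x < y) \<and> sorted_wrt (>) w"
proof
  assume *: "red (x # w) = one_desc (Suc (length w))"
  have nth: "red (x # w) ! Suc i = Suc (length w) - i" if "i < length w" for i
    unfolding * using that by (simp add: one_desc_def rev_nth del: upt_Suc)
  have "red (x # w) ! 0 = 1"
    unfolding * by (simp add: one_desc_def)
  then have "x < w ! i" if "i < length w" for i
    using red_less_iff[of 0 "x # w" "Suc i"] nth[OF that] that
    by (simp add: less_diff_conv)
  moreover have "w ! j < w ! i" if "i < j" "j < length w" for i j
  proof -
    have "Suc (length w) - j < Suc (length w) - i" using that by arith
    then show ?thesis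
      using red_less_iff[of "Suc j" "x # w" "Suc i"] nth[of i] nth[of j] that by simp
  qed
  ultimately show "(\<forall>y\<in>set w. x < y) \<and> sorted_wrt (>) w"
    by (auto simp: sorted_wrt_iff_nth_less in_set_conv_nth)
next
  assume *: "(\<forall>y\<in>set w. x < y) \<and> sorted_wrt (>) w"
  \<comment> \<open>\<open>x\<close> lies below all of \<open>w\<close>, so it raises each rank in
    \<open>w\<close> by one.\<close>
  have "{b \<in> set (x # w). b \<le> a} = insert x {b \<in> set w. b \<le> a}" if "a \<in> set w" for a
    using * that by auto
  moreover have "x \<notin> set w" using * by auto
  ultimately have "map (\<lambda>a. card {b \<in> set (x # w). b \<le> a}) w =
      map Suc (map (\<lambda>a. card {b \<in> set w. b \<le> a}) w)"
    by simp
  also have "\<dots> = rev (map Suc [1..<Suc (length w)])"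
    using * by (simp only: map_rank_decreasing rev_map)
  also have "\<dots> = rev [2..<Suc (Suc (length w))]"
    by (simp only: map_Suc_upt numeral_2_eq_2 One_nat_def)
  finally have "map (\<lambda>a. card {b \<in> set (x # w). b \<le> a}) w = rev [2..<Suc (Suc (length w))]" .
  moreover have "{b \<in> set (x # w). b \<le> x} = {x}" using * by auto
  ultimately show "red (x # w) = one_desc (Suc (length w))"
    unfolding red_def one_desc_def by simp
qed

text \<open>Index sets are split by whether they contain position 0, and the remaining positions are
  shifted down by one.\<close>

lemma occr_Cons:
  "occr \<tau> (x # xs) = occr \<tau> xs +
     card {I. I \<subseteq> {..<length xs} \<and> Suc (card I) = length \<tau> \<and> red (x # nths xs I) = \<tau>}"
proof -
  let ?S = "{I. I \<subseteq> {..<length (x # xs)} \<and> card I = length \<tau> \<and> red (nths (x # xs) I) = \<tau>}"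
  let ?A = "{I. I \<subseteq> {..<length xs} \<and> card I = length \<tau> \<and> red (nths xs I) = \<tau>}"
  let ?B = "{I. I \<subseteq> {..<length xs} \<and> Suc (card I) = length \<tau> \<and> red (x # nths xs I) = \<tau>}"
  have fin: "finite I" if "I \<subseteq> {..<length xs}" for I
    using that by (rule finite_subset) simp
  have nths: "nths (x # xs) (Suc ` I) = nths xs I"
    "nths (x # xs) (insert 0 (Suc ` I)) = x # nths xs I" for I
    by (simp_all add: nths_Cons image_iff)
  have card: "card (insert 0 (Suc ` I)) = Suc (card I)" if "I \<subseteq> {..<length xs}" for I
    using fin[OF that] by (simp add: card_image)
  have "?S = image Suc ` ?A \<union> (\<lambda>I. insert 0 (Suc ` I)) ` ?B"
  proof (intro equalityI subsetI)
    fix I assume I: "I \<in> ?S"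
    define J where "J = {j. Suc j \<in> I}"
    have J: "J \<subseteq> {..<length xs}" using I by (auto simp: J_def)
    show "I \<in> image Suc ` ?A \<union> (\<lambda>I. insert 0 (Suc ` I)) ` ?B"
    proof (cases "0 \<in> I")
      case True
      then have "I = insert 0 (Suc ` J)"
        by (auto simp: J_def image_iff) (metis not0_implies_Suc)
      moreover from this have "J \<in> ?B" using I J card[OF J] nths by auto
      ultimately show ?thesis by blast
    next
      case False
      then have "I = Suc ` J"
        by (auto simp: J_def image_iff) (metis not0_implies_Suc)
      moreover from this have "J \<in> ?A" using I J nths by (auto simp: card_image)
      ultimately show ?thesis by blast
    qed
  next
    fix I assume "I \<in> image Suc ` ?A \<union> (\<lambda>I. insert 0 (Suc ` I)) ` ?B"
    then show "I \<in> ?S"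
      by (auto simp: nths card card_image)
  qed
  then have "card ?S = card (image Suc ` ?A) + card ((\<lambda>I. insert 0 (Suc ` I)) ` ?B)"
    using finite_occr[of xs] by (simp only:) (rule card_Un_disjoint; auto)
  also have "inj_on (\<lambda>I. insert 0 (Suc ` I)) ?B"
    by (rule inj_onI) (auto simp: insert_ident image_iff inj_image_eq_iff)
  then have "card ((\<lambda>I. insert 0 (Suc ` I)) ` ?B) = card ?B" by (rule card_image)
  also have "card (image Suc ` ?A) = card ?A"
    by (intro card_image inj_onI) (simp add: inj_image_eq_iff)
  finally show ?thesis by (simp add: occr_def)
qed

text \<open>The later entries larger than \<open>x\<close> decrease, so any \<open>j - 1\<close> of
  them form an occurrence with \<open>x\<close>, and there are no other occurrences starting at
  \<open>x\<close>.\<close>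

lemma occr_one_desc_Cons:
  assumes "j \<ge> 2" "distinct (x # xs)" "avoids (x # xs)"
  shows "occr (one_desc j) (x # xs) =
    occr (one_desc j) xs + (length (filter (\<lambda>z. x < z) xs) choose (j - 1))"
proof -
  \<comment> \<open>Distinctness makes the weak order in \<open>avoids\<close> strict.\<close>
  have sorted: "sorted_wrt (>) (filter (\<lambda>z. x < z) xs)"
    using assms by (auto simp: sorted_wrt_iff_nth_less order_less_le nth_eq_iff_index_eq)
  let ?D = "{i. i < length xs \<and> x < xs ! i}"
  have "I \<subseteq> {..<length xs} \<and> Suc (card I) = length (one_desc j) \<and> red (x # nths xs I) = one_desc j
      \<longleftrightarrow> I \<subseteq> ?D \<and> card I = j - 1" for I
  proof (cases "I \<subseteq> {..<length xs} \<and> Suc (card I) = j")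
    case True
    then have "{i. i < length xs \<and> i \<in> I} = I" by auto
    then have len: "length (nths xs I) = card I" by (simp add: length_nths)
    have "sorted_wrt (>) (nths xs I)" if "\<forall>y\<in>set (nths xs I). x < y"
    proof -
      have "subseq (nths xs I) (filter (\<lambda>z. x < z) xs)"
        using that subseq_conv_nths by (subst subseq_filter_iff) blast
      then show ?thesis
        using sorted subseq_order.trans unfolding sorted_wrt_iff_subseq by blast
    qed
    then have "red (x # nths xs I) = one_desc j \<longleftrightarrow> (\<forall>y\<in>set (nths xs I). x < y)"
      using red_Cons_eq_one_desc_iff[of x "nths xs I"] len True by auto
    then show ?thesis using True assms(1) by (auto simp: set_nths)
  next
    case False
    then show ?thesis using assms(1) by auto
  qed
  then have "occr (one_desc j) (x # xs) = occr (one_desc j) xs + card {I. I \<subseteq> ?D \<and> card I = j - 1}"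
    by (simp add: occr_Cons)
  also have "card {I. I \<subseteq> ?D \<and> card I = j - 1} = card ?D choose (j - 1)"
    by (rule n_subsets) simp
  finally show ?thesis by (simp add: length_filter_conv_card)
qed

lemma occr_one_desc_Nil [simp]: "j \<ge> 1 \<Longrightarrow> occr (one_desc j) [] = 0"
  by (auto simp: occr_def card_eq_0_iff)

section \<open>Monomials as products over left-to-right minima\<close>

text \<open>Counts the left-to-right minima that a suffix contributes after a prefix with minimum
  \<open>v\<close>; this makes induction along the word possible.\<close>

definition LRmin_below :: "nat \<Rightarrow> nat list \<Rightarrow> nat" where
  "LRmin_below v w = card {j. j < length w \<and> w ! j < v \<and> (\<forall>i<j. w ! i > w ! j)}"

lemma LRmin_below_Nil [simp]: "LRmin_below v [] = 0"
  by (simp add: LRmin_below_def)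

lemma card_less_Suc_split:
  "card {j. j < Suc n \<and> P j} = (if P 0 then 1 else 0) + card {j. j < n \<and> P (Suc j)}"
proof -
  have "{j. j < Suc n \<and> P j} = (if P 0 then {0} else {}) \<union> Suc ` {j. j < n \<and> P (Suc j)}"
    by (auto simp: image_iff less_Suc_eq_0_disj split: if_splits)
  then show ?thesis
    by (simp add: card_image)
qed

lemma LRmin_below_Cons:
  "LRmin_below v (y # ys) = (if y < v then Suc (LRmin_below y ys) else LRmin_below v ys)"
  by (auto simp: LRmin_below_def card_less_Suc_split All_less_Suc2 intro!: arg_cong[where f = card])

lemma weight_eq_monomial:
  fixes s :: "'a :: comm_ring_1"
  assumes "distinct w" "avoids w" "sorted_wrt (\<ge>) (filter (\<lambda>z. v < z) w)" "v \<notin> set w"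
  shows "s ^ LRmin_below v w * (\<Prod>j=2..m. x j ^ occr (one_desc j) w) =
    weight (\<lambda>d. s * (\<Prod>j=2..m. x j ^ (d choose (j - 1)))) v w"
    (is "_ = weight ?f v w")
  using assms
proof (induction w arbitrary: v)
  case (Cons y ys)
  have prod: "(\<Prod>j=2..m. x j ^ occr (one_desc j) (y # ys)) =
      (\<Prod>j=2..m. x j ^ (length (filter (\<lambda>z. y < z) ys) choose (j - 1))) *
      (\<Prod>j=2..m. x j ^ occr (one_desc j) ys)"
    using Cons.prems by (simp add: occr_one_desc_Cons power_add prod.distrib mult.commute)
  show ?case
  proof (cases "y < v")
    case True
    have "weight ?f y ys = s ^ LRmin_below y ys * (\<Prod>j=2..m. x j ^ occr (one_desc j) ys)"
      using Cons.prems by (intro Cons.IH[symmetric]) simp_all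
    with True show ?thesis
      unfolding prod by (simp add: LRmin_below_Cons mult_ac)
  next
    case False
    \<comment> \<open>Here \<open>v < y\<close>, and later entries above \<open>v\<close> are at
      most \<open>y\<close>. So \<open>y\<close> starts no occurrence and contributes no
      factor.\<close>
    then have "filter (\<lambda>z. y < z) ys = []"
      using Cons.prems by (fastforce simp: filter_empty_conv)
    then have "(\<Prod>j=2..m. x j ^ (length (filter (\<lambda>z. y < z) ys) choose (j - 1))) = 1"
      by (intro prod.neutral) (auto simp: binomial_eq_0)
    with False Cons prod show ?thesis by (simp add: LRmin_below_Cons)
  qed
qed simp

lemma Qpoly_eq_paths:
  fixes s :: "'a :: comm_ring_1"
  shows "Qpoly m [1, 2, 3] n s x = paths (\<lambda>d. s * (\<Prod>j=2..m. x j ^ (d choose (j - 1)))) n 0"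
proof -
  let ?f = "\<lambda>d. s * (\<Prod>j=2..m. x j ^ (d choose (j - 1)))"
  have no_large: "filter (\<lambda>z. Suc n < z) w = []" if "w \<in> permutations_of_set {1..n}" for w
    using that by (auto simp: permutations_of_set_def filter_empty_conv)
  have "avoiders n [1, 2, 3] = fillings (Suc n) {1..n}"
    unfolding avoiders_def fillings_def occr_123_eq_0_iff using no_large by auto
  moreover have "LRmin w = LRmin_below (Suc n) w" if "w \<in> permutations_of_set {1..n}" for w
  proof -
    have "w ! j < Suc n" if "j < length w" for j
      using \<open>w \<in> _\<close> nth_mem[OF that] by (simp add: permutations_of_set_def)
    then show ?thesis unfolding LRmin_def LRmin_below_def by meson
  qed
  moreover have "s ^ LRmin_below (Suc n) w * (\<Prod>j=2..m. x j ^ occr (one_desc j) w) =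
      weight ?f (Suc n) w" if "w \<in> fillings (Suc n) {1..n}" for w
    using that by (intro weight_eq_monomial) (auto simp: fillings_def permutations_of_set_def)
  ultimately have "Qpoly m [1, 2, 3] n s x = (\<Sum>w\<in>fillings (Suc n) {1..n}. weight ?f (Suc n) w)"
    unfolding Qpoly_def by (intro sum.cong) (simp_all add: fillings_def)
  also have "\<dots> = paths ?f (card {r \<in> {1..n}. r < Suc n}) (card {r \<in> {1..n}. Suc n < r})"
    by (rule sum_weight_fillings) auto
  also have "{r \<in> {1..n}. r < Suc n} = {1..n}" by auto
  also have "{r \<in> {1..n}. Suc n < r} = {}" by auto
  finally show ?thesis by simp
qed

section \<open>The substitution of variables and the recurrences for the polynomials\<close>

text \<open>After the substitution \<open>x j\<close> has exponent \<open>d choose (j - 1)\<close>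
  from its own place and \<open>d choose (j - 2)\<close> from place \<open>j - 1\<close>; Pascal's
  rule adds them.\<close>

lemma prod_shift_vars:
  fixes x :: "nat \<Rightarrow> 'a :: comm_ring_1"
  assumes "m \<ge> 2"
  shows "x 2 * (\<Prod>j=2..m. shift_vars m x j ^ (d choose (j - 1))) =
    (\<Prod>j=2..m. x j ^ (Suc d choose (j - 1)))"
proof -
  have "(\<Prod>j=2..m. shift_vars m x j ^ (d choose (j - 1))) =
      (\<Prod>j=2..m. x j ^ (d choose (j - 1)) * (if j < m then x (Suc j) ^ (d choose (j - 1)) else 1))"
    by (intro prod.cong) (auto simp: shift_vars_def power_mult_distrib)
  also have "\<dots> = (\<Prod>j=2..m. x j ^ (d choose (j - 1))) *
      (\<Prod>j=2..m. if j < m then x (Suc j) ^ (d choose (j - 1)) else 1)"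
    by (rule prod.distrib)
  also have "(\<Prod>j=2..m. if j < m then x (Suc j) ^ (d choose (j - 1)) else 1) =
      (\<Prod>j\<in>{2..<m}. x (Suc j) ^ (d choose (j - 1)))"
    by (rule prod.mono_neutral_cong_right) auto
  also have "\<dots> = (\<Prod>j\<in>{3..m}. x j ^ (d choose (j - 2)))"
    by (rule prod.reindex_bij_witness[where i = "\<lambda>j. j - 1" and j = Suc]) auto
  finally have "x 2 * (\<Prod>j=2..m. shift_vars m x j ^ (d choose (j - 1))) =
      (\<Prod>j=2..m. x j ^ (d choose (j - 1))) * (x 2 * (\<Prod>j\<in>{3..m}. x j ^ (d choose (j - 2))))"
    by (simp add: mult_ac)
  \<comment> \<open>The extra \<open>x 2\<close> is the missing factor at \<open>j = 2\<close>,
    where the exponent is \<open>d choose 0 = 1\<close>.\<close>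
  also have "x 2 * (\<Prod>j\<in>{3..m}. x j ^ (d choose (j - 2))) = (\<Prod>j=2..m. x j ^ (d choose (j - 2)))"
    using assms by (subst prod.atLeast_Suc_atMost[of 2]) (simp_all add: numeral_3_eq_3)
  also have "(\<Prod>j=2..m. x j ^ (d choose (j - 1))) * (\<Prod>j=2..m. x j ^ (d choose (j - 2))) =
      (\<Prod>j=2..m. x j ^ (Suc d choose (j - 1)))"
  proof (subst prod.distrib[symmetric], rule prod.cong)
    fix j assume "j \<in> {2..m}"
    then obtain k where "j = Suc (Suc k)" by (metis atLeastAtMost_iff add_2_eq_Suc le_Suc_ex)
    then show "x j ^ (d choose (j - 1)) * x j ^ (d choose (j - 2)) = x j ^ (Suc d choose (j - 1))"
      by (simp add: power_add mult.commute)
  qed simp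
  finally show ?thesis .
qed

theorem theorem6:
  fixes m :: nat and s :: "'a :: comm_ring_1" and x :: "nat \<Rightarrow> 'a"
  assumes "m \<ge> 2"
  shows "(\<forall>n\<ge>1. Qpoly m [1, 2, 3] n s x =
            s * Qpoly m [1, 2, 3] (n - 1) s x +
            (\<Sum>k=2..n. Qpoly m [1, 2, 3] (k - 1) (s * x 2) (shift_vars m x) *
                       Qpoly m [1, 2, 3] (n - k) s x)) \<and>
         Qgf m [1, 2, 3] s x =
            1 + fps_X * fps_const (s - 1) * Qgf m [1, 2, 3] s x +
            fps_X * Qgf m [1, 2, 3] (s * x 2) (shift_vars m x) * Qgf m [1, 2, 3] s x"
proof -
  define Q where "Q n = Qpoly m [1, 2, 3] n s x" for n
  define Q' where "Q' n = Qpoly m [1, 2, 3] n (s * x 2) (shift_vars m x)" for n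
  let ?f = "\<lambda>d. s * (\<Prod>j=2..m. x j ^ (d choose (j - 1)))"
  have Q: "Q n = paths ?f n 0" for n
    unfolding Q_def by (rule Qpoly_eq_paths)
  have Q': "Q' n = paths (\<lambda>d. ?f (Suc d)) n 0" for n
    unfolding Q'_def Qpoly_eq_paths mult.assoc prod_shift_vars[OF assms] ..
  \<comment> \<open>All exponents \<open>0 choose (j - 1)\<close> vanish because
    \<open>j \<ge> 2\<close>.\<close>
  have "?f 0 = s"
    by (simp add: binomial_eq_0)
  then have rec: "Q (Suc n) = s * Q n + (\<Sum>k=1..n. Q' k * Q (n - k))" for n
    unfolding Q Q' using paths_recurrence[of ?f n] by simp
  have "Q n = s * Q (n - 1) + (\<Sum>k=2..n. Q' (k - 1) * Q (n - k))" if "n \<ge> 1" for n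
  proof -
    obtain l where n: "n = Suc l" using \<open>n \<ge> 1\<close> by (cases n) auto
    have "(\<Sum>k=2..n. Q' (k - 1) * Q (n - k)) = (\<Sum>k=1..l. Q' k * Q (l - k))"
      unfolding n by (rule sum.reindex_bij_witness[where i = Suc and j = "\<lambda>k. k - 1"]) auto
    then show ?thesis using rec[of l] n by simp
  qed
  moreover have "Qgf m [1, 2, 3] s x =
      1 + fps_X * fps_const (s - 1) * Qgf m [1, 2, 3] s x +
      fps_X * Qgf m [1, 2, 3] (s * x 2) (shift_vars m x) * Qgf m [1, 2, 3] s x"
  proof -
    have gf: "Qgf m [1, 2, 3] s x = Abs_fps Q"
      "Qgf m [1, 2, 3] (s * x 2) (shift_vars m x) = Abs_fps Q'"
      by (simp_all only: Qgf_def flip: Q_def Q'_def)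
    have "Q n = fps_nth (1 + fps_X * (fps_const (s - 1) * Abs_fps Q) +
        fps_X * (Abs_fps Q' * Abs_fps Q)) n" for n
    proof (cases n)
      case 0
      then show ?thesis by (simp add: Q)
    next
      case (Suc l)
      \<comment> \<open>The Cauchy product has the extra term \<open>Q' 0 * Q l = Q l\<close>,
        absent from \<open>rec\<close>; the coefficient \<open>s - 1\<close> in place of
        \<open>s\<close> compensates for it.\<close>
      have "fps_nth (Abs_fps Q' * Abs_fps Q) l = Q l + (\<Sum>k=1..l. Q' k * Q (l - k))"
        by (simp add: fps_mult_nth sum.atLeast_Suc_atMost[of 0] Q')
      then show ?thesis using rec[of l] Suc by (simp add: algebra_simps)
    qed
    then show ?thesis unfolding gf mult.assoc by (intro fps_ext) simp
  qed
  ultimately show ?thesis unfolding Q_def Q'_def by blast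
qed

end
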